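(* For integers $k,l\geq 0$ let $$M_{kl}:=\frac{1}{2\pi}\int_{-\pi}^{\pi}(2\cos\theta)^{2k}(2\sin\theta)^{2l}\,d\theta ,$$ and let $M=[M_{kl}]_{k,l\geq 0}$. Then $M_{kl}=\frac{(2k)!\,(2l)!}{k!\,l!\,(k+l)!}$ for all $k,l\geq 0$, and $M$ admits the factorization $$M=L\,\operatorname{diag}(1,-2,2,-2,2,\dots)\,L^{T},$$ where $L$ is the infinite lower triangular matrix $L=\left[\binom{2i}{i-j}\right]_{i,j\geq 0}$. Consequently, all entries $M_{kl}$ (the super Catalan numbers) are integers, and for every $n\geq 1$ the upper left $n\times n$ block $M^{(n)}$ of $M$ has determinant $(-1)^{\lfloor n/2\rfloor}2^{n-1}$.
   Context: Matrices are indexed by integers $\geq 0$, and $\binom{N}{m}=0$ for $m<0$. The diagonal matrix has $(0,0)$-entry $1$ and $(i,i)$-entry $2(-1)^i$ for $i\geq 1$. Since $L$ is lower triangular, the infinite matrix product involves only finite sums in each entry. *)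

theory Defs
  imports
    "HOL-Analysis.Analysis"
    "HOL-Library.Groups_Big_Fun"
    "Jordan_Normal_Form.Determinant"
begin

type_synonym 'a infmat = "nat \<Rightarrow> nat \<Rightarrow> 'a"

(* Sum_any is 0 when the support is infinite; the two finiteness lemmas below
   show that this does not happen for the products in question. *)
definition inf_mult :: "'a::semiring_0 infmat \<Rightarrow> 'a infmat \<Rightarrow> 'a infmat"
    (infixl "\<star>\<star>" 70) where
  "(A \<star>\<star> B) i j = Sum_any (\<lambda>m. A i m * B m j)"

definition inf_transpose :: "'a infmat \<Rightarrow> 'a infmat" where
  "inf_transpose A i j = A j i"

definition inf_diag :: "(nat \<Rightarrow> 'a::zero) \<Rightarrow> 'a infmat" where
  "inf_diag d i j = (if i = j then d i else 0)"

definition upper_left_block :: "nat \<Rightarrow> 'a infmat \<Rightarrow> 'a mat" where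
  "upper_left_block n A = Matrix.mat n n (\<lambda>(i, j). A i j)"

definition binom :: "nat \<Rightarrow> int \<Rightarrow> nat" where
  "binom N m = (if m < 0 then 0 else N choose nat m)"

definition super_catalan :: "real infmat" where
  "super_catalan k l = 1 / (2 * pi) *
     integral {-pi..pi} (\<lambda>\<theta>. (2 * cos \<theta>) ^ (2 * k) * (2 * sin \<theta>) ^ (2 * l))"

definition binom_mat :: "real infmat" where
  "binom_mat i j = real (binom (2 * i) (int i - int j))"

definition sign_diag :: "nat \<Rightarrow> real" where
  "sign_diag i = (if i = 0 then 1 else 2 * (-1) ^ i)"

lemma finite_support_L_diag: "finite {m. binom_mat i m * inf_diag sign_diag m j \<noteq> 0}"
  by (rule finite_subset[of _ "{..i}"]) (auto simp: binom_mat_def binom_def)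

lemma finite_support_L_diag_LT:
  "finite {m. (binom_mat \<star>\<star> inf_diag sign_diag) i m * inf_transpose binom_mat m j \<noteq> 0}"
  by (rule finite_subset[of _ "{..j}"]) (auto simp: inf_transpose_def binom_mat_def binom_def)

end

theory Submission
  imports Defs
begin

text \<open>
  Write \<open>M\<close> for \<open>super_catalan\<close> and \<open>L\<close> for \<open>binom_mat\<close>. The Fourier cosine expansions
  \<open>(2 cos \<theta>)^(2k) = L(k, 0) + \<Sum>m\<ge>1. 2 L(k, m) cos (2m\<theta>)\<close> and
  \<open>(2 sin \<theta>)^(2l) = L(l, 0) + \<Sum>m\<ge>1. 2 (-1)^m L(l, m) cos (2m\<theta>)\<close>
  (\<open>cos_even_power_fourier\<close> and \<open>sin_even_power_fourier\<close>) have the entries of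
  \<open>L\<close> as coefficients. By orthogonality of the functions \<open>cos (2m\<theta>)\<close> on
  \<open>[-\<pi>, \<pi>]\<close> (\<open>has_integral_cos_mult_cos\<close>), integrating their product yields
  \<open>M(k, l) = \<Sum>m. L(k, m) d(m) L(l, m)\<close> with \<open>d\<close> the diagonal \<open>sign_diag\<close>; this is the factorization
  (\<open>super_catalan_eq_sum\<close>).

  Integrality is immediate, and since \<open>L\<close> is lower triangular with unit diagonal, the
  factorization restricts to the upper left blocks, whose determinants are therefore
  \<open>d(0) \<dots> d(n-1)\<close>. The closed form follows by induction on \<open>l\<close>: the factorization gives
  \<open>M(k, 0) = (2k choose k)\<close>, and \<open>cos\<^sup>2 + sin\<^sup>2 = 1\<close> gives
  \<open>M(k, l+1) = 4 M(k, l) - M(k+1, l)\<close>, a recurrence that the closed form satisfies as well.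
\<close>

section \<open>Fourier expansions of even powers of sine and cosine\<close>

lemma binom_mat_eq: "j \<le> i \<Longrightarrow> binom_mat i j = real ((2 * i) choose (i - j))"
  by (simp add: binom_mat_def binom_def nat_diff_distrib flip: of_nat_diff)

lemma binom_mat_eq_0: "i < j \<Longrightarrow> binom_mat i j = 0"
  by (simp add: binom_mat_def binom_def)

lemma two_cos_power_eq_sum:
  "(2 * cos x) ^ n = (\<Sum>i\<le>n. real (n choose i) * cos ((2 * real i - real n) * x))"
proof -
  have "complex_of_real (2 * cos x) = cis x + cis (- x)"
    by (simp add: complex_eq_iff)
  then have "complex_of_real ((2 * cos x) ^ n) = (cis x + cis (- x)) ^ n"
    by (simp only: of_real_power)
  also have "\<dots> = (\<Sum>i\<le>n. of_nat (n choose i) * cis x ^ i * cis (- x) ^ (n - i))"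
    by (rule binomial_ring)
  also have "\<dots> = (\<Sum>i\<le>n. of_real (real (n choose i)) * cis ((2 * real i - real n) * x))"
  proof (intro sum.cong refl)
    fix i assume "i \<in> {..n}"
    then have "real i * x + real (n - i) * (- x) = (2 * real i - real n) * x"
      by (simp add: of_nat_diff algebra_simps)
    then show "of_nat (n choose i) * cis x ^ i * cis (- x) ^ (n - i) =
        of_real (real (n choose i)) * cis ((2 * real i - real n) * x)"
      by (simp only: Complex.DeMoivre mult.assoc cis_mult of_real_of_nat_eq)
  qed
  finally have "Re (complex_of_real ((2 * cos x) ^ n)) =
      Re (\<Sum>i\<le>n. of_real (real (n choose i)) * cis ((2 * real i - real n) * x))"
    by (rule arg_cong)
  moreover have "Re (complex_of_real a * cis b) = a * cos b" for a b
    by simp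
  ultimately show ?thesis
    by (simp only: Re_sum Re_complex_of_real)
qed

text \<open>
  In the exponential expansion the frequencies \<open>2m\<close> and \<open>-2m\<close> have the same coefficient
  \<open>L(k, m)\<close>, which explains the factor 2 for \<open>m > 0\<close>. The number \<open>n\<close> of terms may
  be any number above \<open>k\<close>, because \<open>L(k, m) = 0\<close> for \<open>m > k\<close>; this allows a common
  range of summation for several rows.
\<close>

lemma cos_even_power_fourier:
  assumes "k < n"
  shows "(2 * cos x) ^ (2 * k) =
    (\<Sum>m<n. (if m = 0 then 1 else 2) * binom_mat k m * cos (2 * real m * x))"
proof -
  define f where "f i = real ((2 * k) choose i) * cos ((2 * real i - real (2 * k)) * x)" for i
  have lo: "f (k - m) = binom_mat k m * cos (2 * real m * x)" if "m \<le> k" for m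
  proof -
    have "(2 * real (k - m) - real (2 * k)) * x = - (2 * real m * x)"
      using that by (simp add: of_nat_diff algebra_simps)
    then show ?thesis
      unfolding f_def using that by (simp only: cos_minus binom_mat_eq)
  qed
  have hi: "f (k + m) = binom_mat k m * cos (2 * real m * x)" if "m \<le> k" for m
  proof -
    have "(2 * real (k + m) - real (2 * k)) * x = 2 * real m * x"
      by (simp add: algebra_simps)
    moreover have "(2 * k) choose (k + m) = (2 * k) choose (k - m)"
      using binomial_symmetric[of "k + m" "2 * k"] that by simp
    ultimately show ?thesis
      unfolding f_def using that by (simp only: binom_mat_eq)
  qed
  have "(2 * cos x) ^ (2 * k) = sum f {..2 * k}"
    unfolding f_def by (rule two_cos_power_eq_sum)
  also have "{..2 * k} = (\<lambda>m. k - m) ` {1..k} \<union> ({k} \<union> (\<lambda>m. k + m) ` {1..k})"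
  proof -
    have "i \<in> (\<lambda>m. k - m) ` {1..k} \<union> ({k} \<union> (\<lambda>m. k + m) ` {1..k})" if "i \<le> 2 * k" for i
    proof (cases "i < k")
      case True
      then have "i = k - (k - i)" "k - i \<in> {1..k}" by auto
      then show ?thesis by blast
    next
      case False
      then have "i = k \<or> (i = k + (i - k) \<and> i - k \<in> {1..k})" using that by auto
      then show ?thesis by blast
    qed
    then show ?thesis by (intro equalityI subsetI) (simp, auto)
  qed
  also have "sum f \<dots> = sum f ((\<lambda>m. k - m) ` {1..k}) + (f k + sum f ((\<lambda>m. k + m) ` {1..k}))"
    by (subst sum.union_disjoint; auto)+
  also have "sum f ((\<lambda>m. k - m) ` {1..k}) = (\<Sum>m=1..k. binom_mat k m * cos (2 * real m * x))"
    by (subst sum.reindex) (auto simp: inj_on_def lo intro!: sum.cong)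
  also have "sum f ((\<lambda>m. k + m) ` {1..k}) = (\<Sum>m=1..k. binom_mat k m * cos (2 * real m * x))"
    by (subst sum.reindex) (auto simp: inj_on_def hi intro!: sum.cong)
  also have "f k = binom_mat k 0"
    using lo[of 0] by simp
  also have "(\<Sum>m=1..k. binom_mat k m * cos (2 * real m * x)) + (binom_mat k 0 +
      (\<Sum>m=1..k. binom_mat k m * cos (2 * real m * x))) =
      binom_mat k 0 + (\<Sum>m=1..k. 2 * binom_mat k m * cos (2 * real m * x))"
    by (simp add: sum_distrib_left mult.assoc flip: mult_2)
  also have "\<dots> = (\<Sum>m\<in>insert 0 {1..k}.
      (if m = 0 then 1 else 2) * binom_mat k m * cos (2 * real m * x))"
    by (subst sum.insert) (auto intro!: sum.cong)
  also have "\<dots> = (\<Sum>m<n. (if m = 0 then 1 else 2) * binom_mat k m * cos (2 * real m * x))"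
    using assms by (intro sum.mono_neutral_left) (auto simp: binom_mat_eq_0)
  finally show ?thesis .
qed

text \<open>
  The sine expansion follows by substituting \<open>\<pi>/2 - x\<close>, which multiplies \<open>cos (2mx)\<close>
  by \<open>(-1)^m\<close>.
\<close>

lemma sin_even_power_fourier:
  assumes "l < n"
  shows "(2 * sin x) ^ (2 * l) =
    (\<Sum>m<n. (if m = 0 then 1 else 2) * (-1) ^ m * binom_mat l m * cos (2 * real m * x))"
proof -
  have "cos (2 * real m * (pi / 2 - x)) = (-1) ^ m * cos (2 * real m * x)" for m
  proof -
    have "2 * real m * (pi / 2 - x) = real m * pi - 2 * real m * x"
      by (simp add: algebra_simps)
    then show ?thesis
      by (simp add: cos_diff)
  qed
  moreover have "sin x = cos (pi / 2 - x)"
    by (simp add: sin_cos_eq)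
  ultimately show ?thesis
    by (simp only: cos_even_power_fourier[OF assms]) (simp add: mult_ac)
qed

section \<open>Orthogonality and the factorization\<close>

lemma has_integral_cos_even_frequency:
  fixes j :: int
  shows "((\<lambda>x. cos (2 * of_int j * x)) has_integral (if j = 0 then 2 * pi else 0)) {-pi..pi}"
proof (cases "j = 0")
  case True
  then show ?thesis
    using has_integral_const_real[of "1::real" "-pi" pi] by simp
next
  case False
  define a :: real where "a = 2 * of_int j"
  have "a \<noteq> 0" using False by (simp add: a_def)
  have "sin (a * pi) = 0"
    unfolding a_def sin_zero_iff_int2 by (rule exI[of _ "2 * j"]) simp
  moreover have "((\<lambda>x. cos (a * x)) has_integral (sin (a * pi) / a - sin (a * (- pi)) / a)) {-pi..pi}"
    using \<open>a \<noteq> 0\<close>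
    by (intro fundamental_theorem_of_calculus)
       (auto intro!: derivative_eq_intros simp: has_real_derivative_iff_has_vector_derivative[symmetric])
  ultimately show ?thesis
    using False by (simp add: a_def)
qed

lemma has_integral_cos_mult_cos:
  "((\<lambda>x. cos (2 * real m * x) * cos (2 * real p * x)) has_integral
     (if m = p then if m = 0 then 2 * pi else pi else 0)) {-pi..pi}"
proof -
  define j where "j = int m - int p"
  define s where "s = int m + int p"
  have "((\<lambda>x. (cos (2 * of_int j * x) + cos (2 * of_int s * x)) / 2) has_integral
      ((if j = 0 then 2 * pi else 0) + (if s = 0 then 2 * pi else 0)) / 2) {-pi..pi}"
    by (intro has_integral_divide has_integral_add has_integral_cos_even_frequency)
  moreover have "(cos (2 * of_int j * x) + cos (2 * of_int s * x)) / 2 =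
      cos (2 * real m * x) * cos (2 * real p * x)" for x
    by (simp add: j_def s_def cos_times_cos algebra_simps)
  moreover have "((if j = 0 then 2 * pi else 0) + (if s = 0 then 2 * pi else 0)) / 2 =
      (if m = p then if m = 0 then 2 * pi else pi else 0)"
    by (auto simp: j_def s_def)
  ultimately show ?thesis by simp
qed

lemma super_catalan_eq_sum:
  assumes "k < n" "l < n"
  shows "super_catalan k l = (\<Sum>m<n. binom_mat k m * sign_diag m * binom_mat l m)"
proof -
  define a where "a m = (if m = 0 then 1 else 2) * binom_mat k m" for m
  define b where "b m = (if m = 0 then 1 else 2) * (-1) ^ m * binom_mat l m" for m
  define v where "v m p = (if m = p then if m = 0 then 2 * pi else pi else 0)" for m p :: nat
  have "((\<lambda>x. \<Sum>m<n. \<Sum>p<n. a m * b p * (cos (2 * real m * x) * cos (2 * real p * x)))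
      has_integral (\<Sum>m<n. \<Sum>p<n. a m * b p * v m p)) {-pi..pi}"
    unfolding v_def
    by (intro has_integral_sum has_integral_mult_right has_integral_cos_mult_cos) auto
  moreover have "(\<Sum>m<n. \<Sum>p<n. a m * b p * (cos (2 * real m * x) * cos (2 * real p * x))) =
      (2 * cos x) ^ (2 * k) * (2 * sin x) ^ (2 * l)" for x
    unfolding cos_even_power_fourier[OF assms(1)] sin_even_power_fourier[OF assms(2)]
    by (simp add: sum_product a_def b_def mult_ac)
  ultimately have "integral {-pi..pi} (\<lambda>x. (2 * cos x) ^ (2 * k) * (2 * sin x) ^ (2 * l)) =
      (\<Sum>m<n. \<Sum>p<n. a m * b p * v m p)"
    by (simp add: integral_unique)
  also have "\<dots> = (\<Sum>m<n. a m * b m * v m m)"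
  proof (rule sum.cong[OF refl])
    fix m assume "m \<in> {..<n}"
    have "(\<Sum>p<n. a m * b p * v m p) = (\<Sum>p<n. if m = p then a m * b m * v m m else 0)"
      by (intro sum.cong) (auto simp: v_def)
    then show "(\<Sum>p<n. a m * b p * v m p) = a m * b m * v m m"
      using \<open>m \<in> {..<n}\<close> by simp
  qed
  also have "\<dots> = (\<Sum>m<n. 2 * pi * (binom_mat k m * sign_diag m * binom_mat l m))"
    by (intro sum.cong) (auto simp: a_def b_def v_def sign_diag_def)
  finally show ?thesis
    by (simp add: super_catalan_def flip: sum_distrib_left)
qed

lemma inf_mult_inf_diag: "(A \<star>\<star> inf_diag d) i j = A i j * (d j :: real)"
proof -
  have "(A \<star>\<star> inf_diag d) i j = (\<Sum>m\<in>{j}. A i m * inf_diag d m j)"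
    unfolding inf_mult_def by (rule Sum_any.expand_superset) (auto simp: inf_diag_def)
  then show ?thesis by (simp add: inf_diag_def)
qed

lemma super_catalan_factorization:
  "super_catalan = binom_mat \<star>\<star> inf_diag sign_diag \<star>\<star> inf_transpose binom_mat"
proof (intro ext)
  fix k l
  define n where "n = Suc (max k l)"
  have "k < n" "l < n" by (auto simp: n_def)
  have "(binom_mat \<star>\<star> inf_diag sign_diag \<star>\<star> inf_transpose binom_mat) k l =
      Sum_any (\<lambda>m. binom_mat k m * sign_diag m * binom_mat l m)"
    by (simp add: inf_mult_def[of "binom_mat \<star>\<star> inf_diag sign_diag"]
        inf_mult_inf_diag inf_transpose_def)
  also have "\<dots> = (\<Sum>m<n. binom_mat k m * sign_diag m * binom_mat l m)"
  proof (rule Sum_any.expand_superset)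
    show "{m. binom_mat k m * sign_diag m * binom_mat l m \<noteq> 0} \<subseteq> {..<n}"
    proof (clarsimp, rule ccontr)
      fix m assume "binom_mat k m \<noteq> 0" "\<not> m < n"
      with \<open>k < n\<close> show False using binom_mat_eq_0[of k m] by linarith
    qed
  qed simp
  also have "\<dots> = super_catalan k l"
    by (rule super_catalan_eq_sum[symmetric]) fact+
  finally show "super_catalan k l =
      (binom_mat \<star>\<star> inf_diag sign_diag \<star>\<star> inf_transpose binom_mat) k l" ..
qed

lemma super_catalan_in_Ints: "super_catalan k l \<in> \<int>"
proof -
  have "binom_mat i j \<in> \<int>" for i j
    by (simp add: binom_mat_def)
  moreover have "sign_diag i \<in> \<int>" for i
    by (simp add: sign_diag_def)
  ultimately show ?thesis
    by (subst super_catalan_eq_sum[of k "Suc (max k l)" l]) auto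
qed

section \<open>The closed form\<close>

lemma super_catalan_Suc_add:
  "super_catalan (Suc k) l + super_catalan k (Suc l) = 4 * super_catalan k l"
proof -
  define f where "f k l x = (2 * cos x) ^ (2 * k) * (2 * sin x :: real) ^ (2 * l)" for k l x
  have int: "f k l integrable_on {-pi..pi}" for k l
    unfolding f_def by (intro integrable_continuous_real continuous_intros)
  have "f (Suc k) l x + f k (Suc l) x = 4 * f k l x" for x
  proof -
    have "f (Suc k) l x + f k (Suc l) x = 4 * ((sin x)\<^sup>2 + (cos x)\<^sup>2) * f k l x"
      unfolding f_def mult_Suc_right power_add power_mult_distrib[of 2 _ 2]
      by (simp add: distrib_left distrib_right mult_ac del: sin_cos_squared_add)
    then show ?thesis by simp
  qed
  then have "integral {-pi..pi} (f (Suc k) l) + integral {-pi..pi} (f k (Suc l)) =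
      4 * integral {-pi..pi} (f k l)"
    by (simp add: int flip: Henstock_Kurzweil_Integration.integral_add)
  moreover have "super_catalan i j = 1 / (2 * pi) * integral {-pi..pi} (f i j)" for i j
    by (simp add: super_catalan_def f_def[abs_def])
  ultimately show ?thesis
    by (simp only: flip: distrib_left)
qed

text \<open>Row 0 of \<open>L\<close> vanishes off the diagonal, so only one summand survives.\<close>

lemma super_catalan_0_right: "super_catalan k 0 = fact (2 * k) / (fact k * fact k)"
proof -
  have "super_catalan k 0 = (\<Sum>m<Suc k. binom_mat k m * sign_diag m * binom_mat 0 m)"
    by (rule super_catalan_eq_sum) auto
  also have "\<dots> = (\<Sum>m\<in>{0}. binom_mat k m * sign_diag m * binom_mat 0 m)"
    by (intro sum.mono_neutral_right) (auto simp: binom_mat_eq_0)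
  also have "\<dots> = real ((2 * k) choose k)"
    by (simp add: binom_mat_eq sign_diag_def)
  also have "\<dots> = fact (2 * k) / (fact k * fact k)"
    by (simp add: binomial_fact)
  finally show ?thesis .
qed

lemma super_catalan_closed_form:
  "super_catalan k l = fact (2 * k) * fact (2 * l) / (fact k * fact l * fact (k + l))"
proof (induction l arbitrary: k)
  case 0
  then show ?case by (simp add: super_catalan_0_right)
next
  case (Suc l)
  define r :: real where
    "r = fact (2 * k) * fact (2 * l) / (fact k * fact l * fact (k + l))"
  have fact_double: "fact (2 * Suc i) = (2 * real (Suc i) * (2 * real i + 1)) * (fact (2 * i) :: real)"
    for i
    by (simp add: algebra_simps)
  have step1: "fact (2 * Suc k) * fact (2 * l) / (fact (Suc k) * fact l * fact (Suc k + l)) =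
      2 * (2 * real k + 1) / real (Suc (k + l)) * r"
    unfolding r_def fact_double by (simp add: divide_simps del: of_nat_Suc)
  have step2: "fact (2 * k) * fact (2 * Suc l) / (fact k * fact (Suc l) * fact (k + Suc l)) =
      2 * (2 * real l + 1) / real (Suc (k + l)) * r"
    unfolding r_def fact_double by (simp add: divide_simps del: of_nat_Suc)
  have "super_catalan k (Suc l) = 4 * r - 2 * (2 * real k + 1) / real (Suc (k + l)) * r"
    using super_catalan_Suc_add[of k l] Suc.IH[of k] Suc.IH[of "Suc k"] step1
    by (simp only: r_def)
  also have "\<dots> = 2 * (2 * real l + 1) / real (Suc (k + l)) * r"
    by (simp add: field_simps)
  finally show ?case by (simp only: step2)
qed

section \<open>Determinants of the upper left blocks\<close>

lemma prod_sign_diag: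
  "n \<ge> 1 \<Longrightarrow> (\<Prod>i<n. sign_diag i) = (-1) ^ (n div 2) * 2 ^ (n - 1)"
proof (induction n rule: nat_induct_at_least)
  case base
  then show ?case by (simp add: sign_diag_def)
next
  case (Suc n)
  have "(-1) ^ (n div 2) * (-1) ^ n = ((-1) ^ (Suc n div 2) :: real)"
    by (cases "even n") (auto elim!: evenE oddE)
  moreover have "(2::real) ^ n = 2 * 2 ^ (n - 1)"
    using Suc.hyps by (cases n) auto
  ultimately show ?case
    using Suc by (simp add: sign_diag_def mult_ac)
qed

lemma det_upper_left_block_super_catalan:
  "Determinant.det (upper_left_block n super_catalan) = (\<Prod>i<n. sign_diag i)"
proof -
  define A where "A = upper_left_block n binom_mat"
  define D where "D = upper_left_block n (inf_diag sign_diag)"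
  have carrier: "A \<in> carrier_mat n n" "D \<in> carrier_mat n n"
    by (auto simp: A_def D_def upper_left_block_def)
  have "upper_left_block n super_catalan = A * D * A\<^sup>T"
  proof (rule eq_matI)
    fix i j assume "i < dim_row (A * D * A\<^sup>T)" "j < dim_col (A * D * A\<^sup>T)"
    then have ij: "i < n" "j < n" using carrier by auto
    have AD: "(A * D) $$ (i, m) = binom_mat i m * sign_diag m" if "m < n" for m
      using ij that
      by (simp add: A_def D_def upper_left_block_def scalar_prod_def inf_diag_def
          if_distrib[of "\<lambda>x. _ * x"] cong: if_cong)
    have A: "A $$ (j, m) = binom_mat j m" if "m < n" for m
      using ij that by (simp add: A_def upper_left_block_def)
    have "(A * D * A\<^sup>T) $$ (i, j) = (\<Sum>m<n. (A * D) $$ (i, m) * A $$ (j, m))"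
    proof -
      define B where "B = A * D"
      have "B \<in> carrier_mat n n" using carrier by (simp add: B_def)
      then show ?thesis
        unfolding B_def[symmetric] using ij carrier
        by (simp add: scalar_prod_def lessThan_atLeast0)
    qed
    also have "\<dots> = (\<Sum>m<n. binom_mat i m * sign_diag m * binom_mat j m)"
      using ij by (intro sum.cong) (auto simp: AD A)
    also have "\<dots> = super_catalan i j"
      using ij by (rule super_catalan_eq_sum[symmetric])
    finally show "upper_left_block n super_catalan $$ (i, j) = (A * D * A\<^sup>T) $$ (i, j)"
      using ij by (simp add: upper_left_block_def)
  qed (use carrier in \<open>auto simp: upper_left_block_def\<close>)
  then have "Determinant.det (upper_left_block n super_catalan) =
      Determinant.det A * Determinant.det D * Determinant.det A"
    using carrier by (simp add: Determinant.det_mult[of _ n] Determinant.det_transpose)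
  moreover have "Determinant.det A = 1"
  proof -
    have "Determinant.det A = prod_list (diag_mat A)"
      using carrier(1)
      by (rule det_lower_triangular[rotated])
         (auto simp: A_def upper_left_block_def binom_mat_eq_0)
    also have "\<dots> = 1"
      by (simp add: prod_list_diag_prod A_def upper_left_block_def binom_mat_eq)
    finally show ?thesis .
  qed
  moreover have "Determinant.det D = (\<Prod>i<n. sign_diag i)"
  proof -
    have "Determinant.det D = prod_list (diag_mat D)"
      using carrier(2)
      by (rule det_lower_triangular[rotated])
         (auto simp: D_def upper_left_block_def inf_diag_def)
    also have "\<dots> = (\<Prod>i<n. sign_diag i)"
      by (simp add: prod_list_diag_prod D_def upper_left_block_def inf_diag_def lessThan_atLeast0)
    finally show ?thesis .
  qed
  ultimately show ?thesis by simp
qed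

theorem mainTheorem5:
  "(\<forall>k l. super_catalan k l =
      fact (2 * k) * fact (2 * l) / (fact k * fact l * fact (k + l))) \<and>
   super_catalan = binom_mat \<star>\<star> inf_diag sign_diag \<star>\<star> inf_transpose binom_mat \<and>
   (\<forall>k l. super_catalan k l \<in> \<int>) \<and>
   (\<forall>n\<ge>1. Determinant.det (upper_left_block n super_catalan) =
      (-1) ^ (n div 2) * 2 ^ (n - 1))"
  using super_catalan_closed_form super_catalan_factorization super_catalan_in_Ints
    det_upper_left_block_super_catalan prod_sign_diag by simp

end
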